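(* Let $a(x)=x+a_2x^2+a_3x^3+\cdots$ be a formal power series with complex coefficients. For $m\in\mathbb{N}$ define numbers $a(n,m)$ ($n\ge m$) by $$\frac{a(x)^m}{m!}=\sum_{n=m}^{\infty}a(n,m)\frac{x^n}{n!}.$$ Then for any $k,n\in\mathbb{N}$ we have $$a(n+k,n)=\sum_{r=1}^k\binom{k-n}{k-r}\binom{k+n}{k+r}a(k+r,r).$$
   Context: $\mathbb{N}$ is the set of positive integers. Binomial coefficients are generalized: for any number $z$ and integer $j\ge 0$, $\binom{z}{j}=\frac{z(z-1)\cdots(z-j+1)}{j!}$ (with $\binom z0=1$); in particular the upper entry may be negative. *)

theory Defs
  imports Complex_Main "HOL-Computational_Algebra.Formal_Power_Series"
begin

end

theory Submission
  imports Defs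
begin

text \<open>
  Write \<open>a = x b\<close> with \<open>b(0) = 1\<close>. Expanding \<open>b^n = (1 + (b - 1))^n\<close> shows that the coefficient of
  \<open>x^k\<close> in \<open>b^n\<close> is a polynomial in \<open>n\<close> of degree at most \<open>k\<close>, so it is recovered by Lagrange
  interpolation from its values at \<open>0, \<dots>, k\<close>. The fundamental Lagrange polynomial at \<open>r\<close> is
  \<open>binom(z, r) binom(k - z, k - r)\<close>. In the basis of the polynomials \<open>binom(z, i)\<close> the
  interpolation formula is Vandermonde's convolution.
\<close>

lemma gbinomial_lagrange_interpolation:
  fixes z :: "'a::field_char_0"
  assumes "i \<le> k"
  shows "(\<Sum>r\<le>k. ((of_nat k - z) gchoose (k - r)) * (z gchoose r) * of_nat (r choose i)) = z gchoose i"
proof -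
  have "(\<Sum>r\<le>k. ((of_nat k - z) gchoose (k - r)) * (z gchoose r) * of_nat (r choose i))
      = (\<Sum>r=i..k. ((of_nat k - z) gchoose (k - r)) * (z gchoose r) * of_nat (r choose i))"
    by (rule sum.mono_neutral_right) auto
  \<comment> \<open>Trinomial revision pulls out the factor free of \<open>r\<close>; what remains
    is a convolution in \<open>r - i\<close>.\<close>
  also have "\<dots> = (\<Sum>r=i..k. (z gchoose i) * (((z - of_nat i) gchoose (r - i)) * ((of_nat k - z) gchoose (k - r))))"
  proof (rule sum.cong)
    fix r assume "r \<in> {i..k}"
    then have "(z gchoose r) * of_nat (r choose i) = (z gchoose i) * ((z - of_nat i) gchoose (r - i))"
      using gbinomial_trinomial_revision[of i r z] by (simp add: binomial_gbinomial)
    then show "((of_nat k - z) gchoose (k - r)) * (z gchoose r) * of_nat (r choose i)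
        = (z gchoose i) * (((z - of_nat i) gchoose (r - i)) * ((of_nat k - z) gchoose (k - r)))"
      by (simp add: mult_ac)
  qed simp
  also have "\<dots> = (z gchoose i) * (\<Sum>r=i..k. ((z - of_nat i) gchoose (r - i)) * ((of_nat k - z) gchoose (k - r)))"
    by (simp add: sum_distrib_left)
  also have "(\<Sum>r=i..k. ((z - of_nat i) gchoose (r - i)) * ((of_nat k - z) gchoose (k - r)))
      = (\<Sum>j=0..k - i. ((z - of_nat i) gchoose j) * ((of_nat k - z) gchoose (k - i - j)))"
    by (rule sum.reindex_bij_witness[of _ "\<lambda>j. j + i" "\<lambda>r. r - i"]) (use assms in auto)
  also have "\<dots> = (z - of_nat i + (of_nat k - z)) gchoose (k - i)"
    by (rule gbinomial_Vandermonde)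
  \<comment> \<open>The two upper entries add up to \<open>k - i\<close>, free of \<open>z\<close>,
    so the convolution is 1.\<close>
  also have "z - of_nat i + (of_nat k - z) = of_nat (k - i)"
    using assms by (simp add: of_nat_diff)
  also have "(of_nat (k - i) :: 'a) gchoose (k - i) = 1"
    by (simp flip: binomial_gbinomial)
  finally show ?thesis by simp
qed

text \<open>The sum stops at \<open>k\<close>, not at \<open>n\<close>, because \<open>b - 1\<close>
  has no constant term and so \<open>(b - 1) ^ i\<close> starts at degree \<open>i\<close> or later.
  With a range independent of \<open>n\<close>, the right-hand side is visibly a polynomial in
  \<open>n\<close>.\<close>

lemma fps_power_nth_binomial:
  fixes b :: "'a::comm_ring_1 fps"
  assumes "fps_nth b 0 = 1"
  shows "fps_nth (b ^ n) k = (\<Sum>i\<le>k. of_nat (n choose i) * fps_nth ((b - 1) ^ i) k)"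
proof -
  let ?t = "\<lambda>i. of_nat (n choose i) * fps_nth ((b - 1) ^ i) k"
  have "b ^ n = (b - 1 + 1) ^ n" by simp
  also have "\<dots> = (\<Sum>i\<le>n. of_nat (n choose i) * (b - 1) ^ i)"
    by (subst binomial_ring) simp
  finally have "fps_nth (b ^ n) k = sum ?t {..n}"
    by (simp add: fps_sum_nth fps_mult_of_nat_nth)
  \<comment> \<open>A common range for both cutoffs: beyond \<open>n\<close> the binomial vanishes,
    beyond \<open>k\<close> the coefficient of \<open>(b - 1) ^ i\<close> does.\<close>
  also have "\<dots> = sum ?t {..max n k}"
    by (rule sum.mono_neutral_left) (auto simp: binomial_eq_0)
  also have "\<dots> = sum ?t {..k}"
  proof (rule sum.mono_neutral_right)
    show "\<forall>i\<in>{..max n k} - {..k}. ?t i = 0"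
      using assms by (simp add: startsby_zero_power_prefix)
  qed auto
  finally show ?thesis .
qed

lemma fps_power_nth_lagrange:
  fixes b :: "'a::field_char_0 fps"
  assumes "fps_nth b 0 = 1"
  shows "fps_nth (b ^ n) k =
    (\<Sum>r\<le>k. ((of_nat k - of_nat n) gchoose (k - r)) * of_nat (n choose r) * fps_nth (b ^ r) k)"
proof -
  let ?L = "\<lambda>r. ((of_nat k - of_nat n :: 'a) gchoose (k - r)) * of_nat (n choose r)"
  let ?c = "\<lambda>i. fps_nth ((b - 1) ^ i) k"
  have "(\<Sum>r\<le>k. ?L r * fps_nth (b ^ r) k) = (\<Sum>r\<le>k. \<Sum>i\<le>k. ?L r * of_nat (r choose i) * ?c i)"
    by (simp add: fps_power_nth_binomial[OF assms] sum_distrib_left mult.assoc)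
  \<comment> \<open>Interpolation is linear, so it suffices to interpolate each basis polynomial
    separately.\<close>
  also have "\<dots> = (\<Sum>i\<le>k. (\<Sum>r\<le>k. ?L r * of_nat (r choose i)) * ?c i)"
    by (subst sum.swap) (simp add: sum_distrib_right)
  also have "\<dots> = (\<Sum>i\<le>k. of_nat (n choose i) * ?c i)"
    using gbinomial_lagrange_interpolation[of _ k "of_nat n :: 'a"]
    by (intro sum.cong) (simp_all add: binomial_gbinomial)
  also have "\<dots> = fps_nth (b ^ n) k"
    by (simp add: fps_power_nth_binomial[OF assms])
  finally show ?thesis by simp
qed

text \<open>For \<open>r \<le> n\<close> both sides equal (k+n)! n! / (n-r)!; otherwise both
  binomials vanish. This converts the Lagrange factor \<open>n choose r\<close> into the binomial of
  the theorem.\<close>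

lemma binomial_add_mult_fact:
  "((k + n) choose (k + r)) * fact (k + r) * fact n = fact (k + n) * (n choose r) * (fact r :: nat)"
proof (cases "r \<le> n")
  case True
  have "fact (n - r) * (((k + n) choose (k + r)) * fact (k + r) * fact n)
      = fact (n - r) * (fact (k + n) * (n choose r) * (fact r :: nat))"
    using binomial_fact_lemma[OF True] binomial_fact_lemma[of "k + r" "k + n"] True
    by (metis (no_types, lifting) add_diff_cancel_left add_left_mono mult.assoc mult.commute)
  then show ?thesis by simp
qed (simp add: binomial_eq_0)

theorem theorem2p2:
  fixes a :: "complex fps" and A :: "nat \<Rightarrow> nat \<Rightarrow> complex" and k n :: nat
  assumes "fps_nth a 0 = 0" and "fps_nth a 1 = 1"
    and "\<And>m. m \<ge> 1 \<Longrightarrow>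
      fps_const (1 / fact m) * a ^ m = Abs_fps (\<lambda>j. if j \<ge> m then A j m / fact j else 0)"
    and "k \<ge> 1" and "n \<ge> 1"
  shows "A (n + k) n =
    (\<Sum>r = 1..k. ((of_nat k - of_nat n) gchoose (k - r)) *
       ((of_nat k + of_nat n) gchoose (k + r)) * A (k + r) r)"
proof -
  define b where "b = fps_shift 1 a"
  have b0: "fps_nth b 0 = 1"
    using assms(2) by (simp add: b_def)
  have a_eq: "a = fps_X * b"
    using assms(1) by (intro fps_ext) (simp add: b_def)
  \<comment> \<open>Since a^r = x^r b^r, the coefficient of x^(k+r) in a^r is that of x^k in
    b^r.\<close>
  have A_eq: "A (k + r) r = fact (k + r) / fact r * fps_nth (b ^ r) k" if "r \<ge> 1" for r
  proof -
    have "fps_nth (fps_const (1 / fact r) * a ^ r) (k + r) = A (k + r) r / fact (k + r)"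
      by (simp add: assms(3)[OF that])
    moreover have "fps_nth (a ^ r) (k + r) = fps_nth (b ^ r) k"
      by (simp add: a_eq power_mult_distrib fps_X_power_mult_nth)
    ultimately show ?thesis by (simp add: field_simps)
  qed
  let ?g = "\<lambda>r. (of_nat k - of_nat n :: complex) gchoose (k - r)"
  have coeff: "((of_nat k + of_nat n :: complex) gchoose (k + r)) * (fact (k + r) / fact r)
      = fact (k + n) / fact n * of_nat (n choose r)" for r
  proof -
    have "(of_nat ((k + n) choose (k + r)) * fact (k + r) * fact n :: complex)
        = fact (k + n) * of_nat (n choose r) * fact r"
      using arg_cong[OF binomial_add_mult_fact[of k n r], of "of_nat :: nat \<Rightarrow> complex"] by simp
    then show ?thesis by (simp add: binomial_gbinomial field_simps)
  qed
  have "A (n + k) n = fact (k + n) / fact n * fps_nth (b ^ n) k"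
    using A_eq[OF assms(5)] by (simp add: add.commute)
  also have "fps_nth (b ^ n) k = (\<Sum>r\<le>k. ?g r * of_nat (n choose r) * fps_nth (b ^ r) k)"
    by (rule fps_power_nth_lagrange[OF b0])
  \<comment> \<open>The node 0 contributes nothing: \<open>b ^ 0 = 1\<close> has zero coefficient at
    x^k, as \<open>k \<ge> 1\<close>.\<close>
  also have "\<dots> = (\<Sum>r=1..k. ?g r * of_nat (n choose r) * fps_nth (b ^ r) k)"
    using assms(4) by (intro sum.mono_neutral_right) (auto simp: not_less_eq_eq)
  also have "fact (k + n) / fact n * \<dots>
      = (\<Sum>r=1..k. ?g r * (fact (k + n) / fact n * of_nat (n choose r)) * fps_nth (b ^ r) k)"
    by (simp add: sum_distrib_left mult_ac)
  also have "\<dots> = (\<Sum>r=1..k. ?g r * ((of_nat k + of_nat n) gchoose (k + r)) * A (k + r) r)"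
  proof (rule sum.cong)
    fix r assume "r \<in> {1..k}"
    then show "?g r * (fact (k + n) / fact n * of_nat (n choose r)) * fps_nth (b ^ r) k
        = ?g r * ((of_nat k + of_nat n) gchoose (k + r)) * A (k + r) r"
      unfolding coeff[symmetric] by (simp only: A_eq atLeastAtMost_iff mult.assoc)
  qed simp
  finally show ?thesis .
qed

end
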